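(* For every positive integer $D$, the complex manifold $\mathcal{L}(D)$ is invariant under the evolution of the truncated Szegő equation $$i\partial_t u=\Pi(|u|^2u)-S\,\Pi\big(|S^\dagger u|^2S^\dagger u\big),$$ that is, if $u$ is the solution with $u(0)=u_0\in\mathcal{L}(D)$, then $u(t)\in\mathcal{L}(D)$ for all $t\in\mathbb{R}$.
   Context: $L^2_+(\mathbb{S}^1)$ is the closed subspace of $L^2(\mathbb{S}^1)$ of functions $u=\sum_{n\ge 0}\alpha_ne^{in\theta}$; such $u$ is identified with $u(z)=\sum_{n\ge0}\alpha_nz^n$. $H^s_+(\mathbb{S}^1)=H^s(\mathbb{S}^1)\cap L^2_+(\mathbb{S}^1)$. $\Pi:L^2(\mathbb{S}^1)\to L^2_+(\mathbb{S}^1)$ is the Szegő projector (removing negative Fourier modes). $S$ is the shift $Sh=e^{i\theta}h$ on $L^2_+$, and $S^\dagger$ is its adjoint, $(S^\dagger h)_n=h_{n+1}$. In Fourier modes the equation reads $i\dot\alpha_0=\sum_{m\ge0}\sum_{k=0}^m\bar\alpha_m\alpha_k\alpha_{m-k}$ and $i\dot\alpha_n=\bar\alpha_0\sum_{k=0}^n\alpha_k\alpha_{n-k}+2\alpha_0\sum_{m\ge1}\bar\alpha_m\alpha_{n+m}$ for $n\ge1$. The equation is globally well-posed in $H^s_+(\mathbb{S}^1)$ for $s>1/2$; "the solution" refers to this flow. $\mathcal{L}(D)$ is the set of rational functions $u(z)=A(z)/B(z)$ where $A,B$ are complex polynomials of degree at most $D$ with no common factors, $\deg A=D$ or $\deg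 B=D$, and $B$ has no zeros in the closed unit disk. *)

theory Defs
  imports "HOL-Analysis.Analysis" "HOL-Computational_Algebra.Computational_Algebra"
begin

(* An element u = (\<Sum>n\<ge>0. \<alpha>\<^sub>n e^{in\<theta>}) of L^2_+(S^1) is represented by its sequence of
   Fourier coefficients \<alpha> :: nat => complex; this avoids choosing representatives of
   almost-everywhere classes.  A general element of L^2(S^1), such as |u|^2 u, is represented
   by a function of the angle \<theta>. *)

definition hardy_fun :: "(nat \<Rightarrow> complex) \<Rightarrow> complex \<Rightarrow> complex" where
  "hardy_fun u z = (\<Sum>n. u n * z ^ n)"

(* H^s_+(S^1).  For s > 1/2 the series defining hardy_fun converges absolutely on the closed
   unit disk, so that the boundary values below are honest pointwise values. *)
definition sobolev_plus :: "real \<Rightarrow> (nat \<Rightarrow> complex) set" where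
  "sobolev_plus s = {u. summable (\<lambda>n. (1 + (real n)\<^sup>2) powr s * (cmod (u n))\<^sup>2)}"

definition sobolev_norm :: "real \<Rightarrow> (nat \<Rightarrow> complex) \<Rightarrow> real" where
  "sobolev_norm s u = sqrt (\<Sum>n. (1 + (real n)\<^sup>2) powr s * (cmod (u n))\<^sup>2)"

definition fourier_coeff :: "(real \<Rightarrow> complex) \<Rightarrow> int \<Rightarrow> complex" where
  "fourier_coeff f n =
     (LINT \<theta>:{0..2*pi}|lebesgue. f \<theta> * cis (- (real_of_int n * \<theta>))) / complex_of_real (2 * pi)"

(* The Szego projector: keep the nonnegative Fourier modes only. *)
definition szego_proj :: "(real \<Rightarrow> complex) \<Rightarrow> nat \<Rightarrow> complex" where
  "szego_proj f n = fourier_coeff f (int n)"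

(* Multiplication by e^{i\<theta>}. *)
definition shift :: "(nat \<Rightarrow> complex) \<Rightarrow> nat \<Rightarrow> complex" where
  "shift h n = (case n of 0 \<Rightarrow> 0 | Suc m \<Rightarrow> h m)"

definition shift_adj :: "(nat \<Rightarrow> complex) \<Rightarrow> nat \<Rightarrow> complex" where
  "shift_adj h n = h (Suc n)"

(* The function |u|^2 u on the circle. *)
definition cubic :: "(nat \<Rightarrow> complex) \<Rightarrow> real \<Rightarrow> complex" where
  "cubic u \<theta> = complex_of_real ((cmod (hardy_fun u (cis \<theta>)))\<^sup>2) * hardy_fun u (cis \<theta>)"

definition truncated_szego_rhs :: "(nat \<Rightarrow> complex) \<Rightarrow> nat \<Rightarrow> complex" where
  "truncated_szego_rhs u n =
     szego_proj (cubic u) n - shift (szego_proj (cubic (shift_adj u))) n"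

(* u is a global solution of class C(R; H^s_+).  The time derivative is taken in each Fourier
   mode; for s > 1/2 the right-hand side is continuous from H^s_+ to itself, so u is then
   automatically of class C^1(R; H^s_+). *)
definition truncated_szego_solution :: "real \<Rightarrow> (real \<Rightarrow> nat \<Rightarrow> complex) \<Rightarrow> bool" where
  "truncated_szego_solution s u \<longleftrightarrow>
     (\<forall>t. u t \<in> sobolev_plus s) \<and>
     (\<forall>t. ((\<lambda>r. sobolev_norm s (\<lambda>n. u r n - u t n)) \<longlongrightarrow> 0) (at t)) \<and>
     (\<forall>t n. \<exists>du. ((\<lambda>r. u r n) has_vector_derivative du) (at t) \<and>
                 \<i> * du = truncated_szego_rhs (u t) n)"

definition rational_manifold :: "nat \<Rightarrow> (nat \<Rightarrow> complex) set" where
  "rational_manifold D = {u. \<exists>A B :: complex poly.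
     degree A \<le> D \<and> degree B \<le> D \<and> coprime A B \<and> (degree A = D \<or> degree B = D) \<and>
     (\<forall>z\<in>cball 0 1. poly B z \<noteq> 0) \<and>
     (\<forall>z\<in>cball 0 1. (\<lambda>n. u n * z ^ n) sums (poly A z / poly B z))}"

end

theory Submission
  imports Defs "Jordan_Normal_Form.Determinant" "HOL-Computational_Algebra.Field_as_Ring"
begin

text \<open>By Kronecker's theorem, \<open>u\<close> is a quotient of polynomials of degree at most \<open>D\<close> iff its shifted
  Hankel matrix \<open>\<Gamma> = (u\<^bsub>n+m+1\<^esub>)\<close> has rank at most \<open>D\<close>, that is, iff all its minors of size
  \<open>D + 1\<close> vanish. Along a solution, \<open>\<Gamma>' = X \<Gamma> + \<Gamma> X\<^sup>T\<close> for a matrix \<open>X\<close> whose rows are bounded in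
  \<open>\<ell>\<^sup>1\<close>, because \<open>H\<^sup>s\<close> embeds into the Wiener algebra for \<open>s > 1/2\<close>. The derivative of a minor is then
  an \<open>\<ell>\<^sup>1\<close>-combination of minors of the same size, so a Gronwall argument in the supremum norm over
  all minors of that size shows that if they all vanish at one time, they vanish at all times.
  Applied forwards and backwards in time, this preserves the exact rank.\<close>

section \<open>Minors along a linear flow\<close>

text \<open>The index maps are arbitrary functions, not only increasing ones, so that replacing one
  index by a summation index stays within the family; a repeated index merely gives a zero
  minor.\<close>

definition minor :: "nat \<Rightarrow> (nat \<Rightarrow> nat \<Rightarrow> complex) \<Rightarrow> (nat \<Rightarrow> nat) \<Rightarrow> (nat \<Rightarrow> nat) \<Rightarrow> complex" where
  "minor k G I J = Determinant.det (mat k k (\<lambda>(p, q). G (I p) (J q)))"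

lemma minor_leibniz:
  "minor k G I J = (\<Sum>\<sigma> | \<sigma> permutes {..<k}. of_int (sign \<sigma>) * (\<Prod>p<k. G (I p) (J (\<sigma> p))))"
proof -
  have "(\<Prod>p<k. mat k k (\<lambda>(p, q). G (I p) (J q)) $$ (p, \<sigma> p)) = (\<Prod>p<k. G (I p) (J (\<sigma> p)))"
    if "\<sigma> permutes {..<k}" for \<sigma>
  proof -
    have "\<sigma> p < k" if "p < k" for p
      using permutes_in_image[OF \<open>\<sigma> permutes _\<close>, of p] that by simp
    then show ?thesis
      by (auto intro!: prod.cong)
  qed
  then show ?thesis
    unfolding minor_def Determinant.det_def by (auto simp: atLeast0LessThan intro!: sum.cong)
qed

lemma minor_swap: "minor k G I J = minor k (\<lambda>i j. G j i) J I"
proof -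
  have "transpose_mat (mat k k (\<lambda>(p, q). G (I p) (J q))) = mat k k (\<lambda>(p, q). G (I q) (J p))"
    by auto
  then show ?thesis
    unfolding minor_def
    using Determinant.det_transpose[of "mat k k (\<lambda>(p, q). G (I p) (J q))" k] by simp
qed

text \<open>The Leibniz formula has \<open>fact k\<close> terms. Uniformity in \<open>I\<close> and
  \<open>J\<close> supplies the finite common bound from which the Gronwall argument starts.\<close>

lemma norm_minor_le:
  assumes "\<And>i j. norm (G i j) \<le> B"
  shows "norm (minor k G I J) \<le> fact k * B ^ k"
proof -
  have "norm (minor k G I J)
      \<le> (\<Sum>\<sigma> | \<sigma> permutes {..<k}. norm (of_int (sign \<sigma>) * (\<Prod>p<k. G (I p) (J (\<sigma> p)))))"
    unfolding minor_leibniz by (rule norm_sum)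
  also have "\<dots> \<le> (\<Sum>\<sigma> | \<sigma> permutes {..<k}. B ^ k)"
  proof (rule sum_mono)
    fix \<sigma>
    have "norm (of_int (sign \<sigma>) * (\<Prod>p<k. G (I p) (J (\<sigma> p)))) = (\<Prod>p<k. norm (G (I p) (J (\<sigma> p))))"
      by (simp add: norm_mult prod_norm sign_def)
    also have "\<dots> \<le> (\<Prod>p<k. B)"
      by (rule prod_mono) (simp add: assms)
    finally show "norm (of_int (sign \<sigma>) * (\<Prod>p<k. G (I p) (J (\<sigma> p)))) \<le> B ^ k"
      by simp
  qed
  also have "\<dots> = fact k * B ^ k"
    by (simp add: card_permutations)
  finally show ?thesis .
qed

text \<open>The differential of the determinant at \<open>g\<close> in the direction
  \<open>c\<close>, with the product rule already applied to the Leibniz formula.\<close>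

definition minor_variation ::
  "nat \<Rightarrow> (nat \<Rightarrow> nat \<Rightarrow> complex) \<Rightarrow> (nat \<Rightarrow> nat \<Rightarrow> complex) \<Rightarrow> complex" where
  "minor_variation k g c =
     (\<Sum>\<sigma> | \<sigma> permutes {..<k}. of_int (sign \<sigma>) *
        (\<Sum>p<k. c p (\<sigma> p) * (\<Prod>q\<in>{..<k} - {p}. g q (\<sigma> q))))"

text \<open>Differentiated invariance under transposition: inverting \<open>\<sigma>\<close> keeps
  its sign, and reindexing \<open>p\<close> as \<open>\<sigma> p\<close> exchanges rows and columns.
  It reduces column estimates to row estimates.\<close>

lemma minor_variation_swap:
  "minor_variation k g c = minor_variation k (\<lambda>i j. g j i) (\<lambda>i j. c j i)"
proof -
  have "(\<Sum>p<k. c p (inv_into UNIV \<sigma> p) * (\<Prod>q\<in>{..<k} - {p}. g q (inv_into UNIV \<sigma> q)))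
      = (\<Sum>p<k. c (\<sigma> p) p * (\<Prod>q\<in>{..<k} - {p}. g (\<sigma> q) q))"
    if \<sigma>: "\<sigma> permutes {..<k}" for \<sigma>
  proof -
    have inv: "inv_into UNIV \<sigma> (\<sigma> p) = p" for p
      by (simp add: permutes_inverses[OF \<sigma>])
    have "(\<Sum>p<k. c p (inv_into UNIV \<sigma> p) * (\<Prod>q\<in>{..<k} - {p}. g q (inv_into UNIV \<sigma> q)))
        = (\<Sum>p<k. c (\<sigma> p) p * (\<Prod>q\<in>{..<k} - {\<sigma> p}. g q (inv_into UNIV \<sigma> q)))"
      by (subst sum.permute[OF \<sigma>]) (simp add: inv)
    also have "\<dots> = (\<Sum>p<k. c (\<sigma> p) p * (\<Prod>q\<in>{..<k} - {p}. g (\<sigma> q) q))"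
    proof (rule sum.cong[OF refl])
      fix p
      have "{..<k} - {\<sigma> p} = \<sigma> ` ({..<k} - {p})"
        using permutes_image[OF \<sigma>] permutes_inj[OF \<sigma>] by (auto simp: inj_def)
      moreover have "inj_on \<sigma> ({..<k} - {p})"
        using permutes_inj[OF \<sigma>] by (rule inj_on_subset) simp
      ultimately have "(\<Prod>q\<in>{..<k} - {\<sigma> p}. g q (inv_into UNIV \<sigma> q)) = (\<Prod>q\<in>{..<k} - {p}. g (\<sigma> q) q)"
        by (simp add: prod.reindex inv)
      then show "c (\<sigma> p) p * (\<Prod>q\<in>{..<k} - {\<sigma> p}. g q (inv_into UNIV \<sigma> q))
          = c (\<sigma> p) p * (\<Prod>q\<in>{..<k} - {p}. g (\<sigma> q) q)" by simp
    qed
    finally show ?thesis .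
  qed
  moreover have "sign (inv_into UNIV \<sigma>) = sign \<sigma>" if "\<sigma> permutes {..<k}" for \<sigma>
    using that by (meson finite_lessThan permutation_permutes sign_inverse)
  ultimately show ?thesis
    unfolding minor_variation_def by (subst sum_permutations_inverse) (auto intro!: sum.cong)
qed

lemma minor_variation_add:
  "minor_variation k g (\<lambda>i j. c i j + d i j) = minor_variation k g c + minor_variation k g d"
  unfolding minor_variation_def by (simp add: algebra_simps sum.distrib)

lemma has_vector_derivative_minor:
  assumes "\<And>i j. ((\<lambda>r. G r i j) has_vector_derivative G' i j) (at t)"
  shows "((\<lambda>r. minor k (G r) I J) has_vector_derivative
           minor_variation k (\<lambda>p q. G t (I p) (J q)) (\<lambda>p q. G' (I p) (J q))) (at t)"
proof -
  have "((\<lambda>r. \<Prod>p<k. G r (I p) (J (\<sigma> p))) has_vector_derivative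
      (\<Sum>p<k. G' (I p) (J (\<sigma> p)) * (\<Prod>q\<in>{..<k} - {p}. G t (I q) (J (\<sigma> q))))) (at t)" for \<sigma>
    using has_derivative_prod[of "{..<k}" "\<lambda>p r. G r (I p) (J (\<sigma> p))"
        "\<lambda>p h. h *\<^sub>R G' (I p) (J (\<sigma> p))" t UNIV] assms
    unfolding has_vector_derivative_def by (simp add: scaleR_sum_right)
  then show ?thesis
    unfolding minor_leibniz minor_variation_def
    by (intro has_vector_derivative_sum has_vector_derivative_mult_right)
qed

text \<open>Determinants are linear in each row. If row \<open>p\<close> of the variation is a
  series of rows of \<open>G\<close>, its contribution is the same series of minors of
  \<open>G\<close> with \<open>I p\<close> replaced by \<open>l\<close>; each of the
  \<open>k\<close> rows then costs at most \<open>K * b\<close>.\<close>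

lemma minor_variation_rows:
  assumes x: "\<And>p q. p < k \<Longrightarrow> q < k \<Longrightarrow> (\<lambda>l. a p l * G l (J q)) sums x p q"
    and row: "\<And>p. p < k \<Longrightarrow> summable (\<lambda>l. norm (a p l))"
      "\<And>p. p < k \<Longrightarrow> (\<Sum>l. norm (a p l)) \<le> K"
    and b: "\<And>I. norm (minor k G I J) \<le> b"
  shows "norm (minor_variation k (\<lambda>p q. G (I p) (J q)) x) \<le> real k * K * b"
proof -
  have eq: "minor_variation k (\<lambda>p q. G (I p) (J q)) x = (\<Sum>p<k. \<Sum>l. a p l * minor k G (I(p := l)) J)"
  proof -
    have "(\<lambda>l. a p l * minor k G (I(p := l)) J) sums
        (\<Sum>\<sigma> | \<sigma> permutes {..<k}. of_int (sign \<sigma>) *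
          (x p (\<sigma> p) * (\<Prod>q\<in>{..<k} - {p}. G (I q) (J (\<sigma> q)))))" if p: "p < k" for p
    proof -
      have "(\<lambda>l. \<Sum>\<sigma> | \<sigma> permutes {..<k}. of_int (sign \<sigma>) *
            (a p l * G l (J (\<sigma> p)) * (\<Prod>q\<in>{..<k} - {p}. G (I q) (J (\<sigma> q))))) sums
          (\<Sum>\<sigma> | \<sigma> permutes {..<k}. of_int (sign \<sigma>) *
            (x p (\<sigma> p) * (\<Prod>q\<in>{..<k} - {p}. G (I q) (J (\<sigma> q)))))"
        using p by (intro sums_sum sums_mult sums_mult2 x) (auto simp: permutes_in_image[where S="{..<k}", simplified])
      moreover have "(\<Sum>\<sigma> | \<sigma> permutes {..<k}. of_int (sign \<sigma>) *
            (a p l * G l (J (\<sigma> p)) * (\<Prod>q\<in>{..<k} - {p}. G (I q) (J (\<sigma> q)))))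
          = a p l * minor k G (I(p := l)) J" for l
      proof -
        have "(\<Prod>q<k. G ((I(p := l)) q) (J (\<sigma> q)))
            = G l (J (\<sigma> p)) * (\<Prod>q\<in>{..<k} - {p}. G (I q) (J (\<sigma> q)))" for \<sigma>
          using p by (subst prod.remove[of _ p]) auto
        then show ?thesis
          unfolding minor_leibniz by (simp add: sum_distrib_left mult_ac)
      qed
      ultimately show ?thesis by simp
    qed
    then have "(\<Sum>l. a p l * minor k G (I(p := l)) J) =
        (\<Sum>\<sigma> | \<sigma> permutes {..<k}. of_int (sign \<sigma>) *
          (x p (\<sigma> p) * (\<Prod>q\<in>{..<k} - {p}. G (I q) (J (\<sigma> q)))))" if "p < k" for p
      using that by (simp add: sums_iff)
    then show ?thesis
      unfolding minor_variation_def
      by (simp add: sum_distrib_left) (rule sum.swap)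
  qed
  have "norm (\<Sum>l. a p l * minor k G (I(p := l)) J) \<le> K * b" if p: "p < k" for p
  proof -
    have b0: "0 \<le> b" using b[of I] norm_ge_zero order_trans by blast
    have le: "norm (a p l * minor k G (I(p := l)) J) \<le> norm (a p l) * b" for l
      unfolding norm_mult by (intro mult_left_mono b) simp
    have "norm (\<Sum>l. a p l * minor k G (I(p := l)) J) \<le> (\<Sum>l. norm (a p l) * b)"
      using le by (intro norm_suminf_le summable_mult2 row p)
    also have "\<dots> = (\<Sum>l. norm (a p l)) * b"
      using row(1)[OF p] by (rule suminf_mult2[symmetric])
    also have "\<dots> \<le> K * b"
      using b0 row(2)[OF p] by (rule mult_right_mono[rotated])
    finally show ?thesis .
  qed
  then have "(\<Sum>p<k. norm (\<Sum>l. a p l * minor k G (I(p := l)) J)) \<le> (\<Sum>p<k. K * b)"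
    by (intro sum_mono) simp
  then show ?thesis
    unfolding eq using norm_sum order_trans by fastforce
qed

section \<open>Gronwall argument for all minors of one size\<close>

lemma summable_mult_bounded:
  fixes a f :: "nat \<Rightarrow> complex"
  assumes "summable (\<lambda>l. norm (a l))" "\<And>l. norm (f l) \<le> B"
  shows "summable (\<lambda>l. a l * f l)"
proof (rule summable_comparison_test'[where N=0])
  show "summable (\<lambda>l. norm (a l) * B)"
    using assms(1) by (rule summable_mult2)
  show "norm (a l * f l) \<le> norm (a l) * B" for l
    unfolding norm_mult by (intro mult_left_mono assms) simp
qed

text \<open>\<open>a n\<close> acts on rows and \<open>a m\<close> on columns; the column part is
  the row estimate for the transposed matrix, whence the factor 2. As \<open>d\<close> is chosen
  before \<open>b\<close>, every common bound of the minors controls the same derivative.\<close>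

lemma minor_flow_derivative_bound:
  assumes der: "\<And>n m. ((\<lambda>r. G r n m) has_vector_derivative
        (\<Sum>l. a n l * G t l m) + (\<Sum>l. a m l * G t n l)) (at t)"
    and row: "\<And>n. summable (\<lambda>l. norm (a n l))" "\<And>n. (\<Sum>l. norm (a n l)) \<le> K"
    and bnd: "\<And>n m. norm (G t n m) \<le> B"
  shows "\<exists>d. ((\<lambda>r. minor k (G r) I J) has_vector_derivative d) (at t) \<and>
           (\<forall>b. (\<forall>I J. norm (minor k (G t) I J) \<le> b) \<longrightarrow> norm d \<le> (2 * real k * K) * b)"
proof -
  let ?R = "\<lambda>p q. \<Sum>l. a (I p) l * G t l (J q)"
  let ?C = "\<lambda>p q. \<Sum>l. a (J q) l * G t (I p) l"
  let ?g = "\<lambda>p q. G t (I p) (J q)"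
  have "norm (minor_variation k ?g (\<lambda>p q. ?R p q + ?C p q)) \<le> (2 * real k * K) * b"
    if b: "\<And>I J. norm (minor k (G t) I J) \<le> b" for b
  proof -
    have R: "norm (minor_variation k ?g ?R) \<le> real k * K * b"
      by (rule minor_variation_rows[where a="\<lambda>p. a (I p)"])
        (rule summable_sums summable_mult_bounded[where B=B] row bnd b)+
    have b': "norm (minor k (\<lambda>i j. G t j i) I J) \<le> b" for I J
      using b[of J I] by (simp only: minor_swap[of k _ I J])
    have C: "norm (minor_variation k (\<lambda>p q. ?g q p) (\<lambda>p q. ?C q p)) \<le> real k * K * b"
      by (rule minor_variation_rows[where a="\<lambda>p. a (J p)" and G="\<lambda>i j. G t j i"])
        (rule summable_sums summable_mult_bounded[where B=B] row bnd b')+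
    have "minor_variation k ?g (\<lambda>p q. ?R p q + ?C p q)
        = minor_variation k ?g ?R + minor_variation k (\<lambda>p q. ?g q p) (\<lambda>p q. ?C q p)"
      by (simp only: minor_variation_add minor_variation_swap[of k ?g ?C])
    then show ?thesis
      using norm_triangle_mono[OF R C] by (simp add: algebra_simps)
  qed
  then show ?thesis
    using has_vector_derivative_minor[where G=G and G'="\<lambda>n m. (\<Sum>l. a n l * G t l m) + (\<Sum>l. a m l * G t n l)", OF der]
    by blast
qed

text \<open>Gronwall for an infinite family without forming its supremum: a common bound
  \<open>b\<close> on the ball bounds all derivatives by \<open>K * b\<close>, and integrating from
  the zero at \<open>c\<close> over a length below \<open>\<delta>\<close> improves \<open>b\<close>
  to \<open>b / 2\<close>. Iteration leaves only 0.\<close>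

lemma vanishing_family:
  fixes f :: "'i \<Rightarrow> real \<Rightarrow> complex"
  assumes init: "\<And>i. f i c = 0"
    and der: "\<And>i t. t \<in> ball c \<delta> \<Longrightarrow> \<exists>d. (f i has_vector_derivative d) (at t) \<and>
               (\<forall>b. (\<forall>j. norm (f j t) \<le> b) \<longrightarrow> norm d \<le> K * b)"
    and bnd: "\<And>i t. t \<in> ball c \<delta> \<Longrightarrow> norm (f i t) \<le> B"
    and \<delta>: "0 < \<delta>" "K * \<delta> \<le> 1/2"
    and t: "t \<in> ball c \<delta>"
  shows "f i t = 0"
proof -
  define d where "d i t = vector_derivative (f i) (at t)" for i t
  have d: "(f i has_vector_derivative d i t) (at t)" if "t \<in> ball c \<delta>" for i t
    using der[OF that, of i] vector_derivative_at unfolding d_def by blast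
  have d_le: "norm (d i t) \<le> K * b" if "t \<in> ball c \<delta>" "\<And>j. norm (f j t) \<le> b" for i t b
    using der[OF that(1), of i] that(2) vector_derivative_at unfolding d_def by blast
  have halve: "norm (f i t) \<le> b / 2"
    if b: "\<And>j r. r \<in> ball c \<delta> \<Longrightarrow> norm (f j r) \<le> b" and t: "t \<in> ball c \<delta>" for b i t
  proof -
    have b0: "0 \<le> b" using b[OF t] norm_ge_zero order_trans by blast
    \<comment> \<open>\<open>K\<close> itself carries no sign condition; the sign of
      \<open>K * b\<close> is read off from a norm below it.\<close>
    have Kb: "0 \<le> K * b" using d_le[OF t b[OF t]] norm_ge_zero order_trans by blast
    have "norm (f i t - f i c) \<le> (K * b) * norm (t - c)"
    proof (rule differentiable_bound[where S="ball c \<delta>"])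
      show "(f i has_derivative (\<lambda>h. h *\<^sub>R d i r)) (at r within ball c \<delta>)" if "r \<in> ball c \<delta>" for r
        using d[OF that] has_derivative_at_withinI unfolding has_vector_derivative_def by blast
      show "onorm (\<lambda>h. h *\<^sub>R d i r) \<le> K * b" if "r \<in> ball c \<delta>" for r
        using mult_left_mono[OF d_le[OF that b[OF that]] abs_ge_zero]
        by (intro onorm_le) (simp add: mult.commute)
    qed (use t \<delta> in auto)
    also have "\<dots> \<le> (K * b) * \<delta>"
      using t Kb by (intro mult_left_mono) (auto simp: dist_norm norm_minus_commute)
    also have "\<dots> = (K * \<delta>) * b" by simp
    also have "\<dots> \<le> 1/2 * b"
      using \<delta>(2) b0 by (rule mult_right_mono)
    finally show ?thesis by (simp add: init)
  qed
  have "norm (f i t) \<le> B * (1/2) ^ n" if "t \<in> ball c \<delta>" for n i t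
    using that
  proof (induction n arbitrary: i t)
    case 0
    then show ?case using bnd by simp
  next
    case (Suc n)
    from halve[OF Suc.IH Suc.prems] show ?case by simp
  qed
  moreover have "(\<lambda>n. B * (1/2) ^ n) \<longlonglongrightarrow> 0"
    by (intro tendsto_mult_right_zero LIMSEQ_power_zero) simp
  ultimately have "norm (f i t) \<le> 0"
    using t by (intro LIMSEQ_le_const) auto
  then show ?thesis by simp
qed

text \<open>The times at which all minors of size \<open>k\<close> vanish form a closed set, as
  minors are continuous in time, and an open one, by the local Gronwall argument. The real line is
  connected.\<close>

lemma minors_vanish_forever:
  assumes der: "\<And>t n m. ((\<lambda>r. G r n m) has_vector_derivative
        (\<Sum>l. a t n l * G t l m) + (\<Sum>l. a t m l * G t n l)) (at t)"
    and row: "\<And>t n. summable (\<lambda>l. norm (a t n l))" "\<And>t n. (\<Sum>l. norm (a t n l)) \<le> K t"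
    and bnd: "\<And>t n m. norm (G t n m) \<le> B t"
    and cont: "continuous_on UNIV K" "continuous_on UNIV B"
    and init: "\<And>I J. minor k (G \<tau>) I J = 0"
  shows "minor k (G t) I J = 0"
proof -
  define Z where "Z = {t. \<forall>I J. minor k (G t) I J = 0}"
  have "closed Z"
  proof -
    have "continuous_on UNIV (\<lambda>t. minor k (G t) I J)" for I J
      using has_vector_derivative_minor[where G=G and
          G'="\<lambda>n m. (\<Sum>l. a t n l * G t l m) + (\<Sum>l. a t m l * G t n l)" for t, OF der]
      by (meson continuous_at_imp_continuous_on has_vector_derivative_continuous)
    then show ?thesis
      unfolding Z_def by (intro closed_Collect_all closed_Collect_eq) auto
  qed
  moreover have "open Z"
    unfolding open_contains_ball
  proof
    fix \<tau> assume \<tau>: "\<tau> \<in> Z"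
    have loc: "\<exists>e>0. \<forall>t\<in>ball \<tau> e. f t < f \<tau> + 1" if "continuous_on UNIV f" for f :: "real \<Rightarrow> real"
    proof -
      have "open {t. f t < f \<tau> + 1}"
        using that by (intro open_Collect_less continuous_intros)
      moreover have "\<tau> \<in> {t. f t < f \<tau> + 1}" by simp
      ultimately obtain e where "e > 0" "ball \<tau> e \<subseteq> {t. f t < f \<tau> + 1}"
        unfolding open_contains_ball by blast
      then show ?thesis by blast
    qed
    obtain e1 where e1: "e1 > 0" "\<And>t. t \<in> ball \<tau> e1 \<Longrightarrow> K t < K \<tau> + 1"
      using loc[OF cont(1)] by blast
    obtain e2 where e2: "e2 > 0" "\<And>t. t \<in> ball \<tau> e2 \<Longrightarrow> B t < B \<tau> + 1"
      using loc[OF cont(2)] by blast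
    have "0 \<le> K \<tau>" using row(2)[of \<tau> 0] suminf_nonneg[OF row(1)[of \<tau> 0]] by simp
    \<comment> \<open>Near \<open>\<tau>\<close> the derivative constant is at most
      \<open>2 * real k * (K \<tau> + 1)\<close>. Adding 1 keeps \<open>L\<close> positive also for
      \<open>k = 0\<close>, so that the radius \<open>1 / (2 * L)\<close> makes sense.\<close>
    define L where "L = 2 * real k * (K \<tau> + 1) + 1"
    have L: "L \<ge> 1" using \<open>0 \<le> K \<tau>\<close> by (simp add: L_def)
    define \<delta> where "\<delta> = min (min e1 e2) (1 / (2 * L))"
    have \<delta>: "\<delta> > 0" "\<delta> \<le> e1" "\<delta> \<le> e2" "L * \<delta> \<le> 1/2"
    proof -
      show "\<delta> > 0" "\<delta> \<le> e1" "\<delta> \<le> e2" using e1 e2 L by (auto simp: \<delta>_def)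
      have "L * \<delta> \<le> L * (1 / (2 * L))" using L by (intro mult_left_mono) (auto simp: \<delta>_def)
      then show "L * \<delta> \<le> 1/2" using L by simp
    qed
    define M where "M IJ t = minor k (G t) (fst IJ) (snd IJ)" for IJ :: "(nat \<Rightarrow> nat) \<times> (nat \<Rightarrow> nat)" and t
    have M0: "M IJ t = 0" if t: "t \<in> ball \<tau> \<delta>" for t IJ
    proof (rule vanishing_family[where f=M and \<delta>=\<delta> and c=\<tau> and t=t
            and K=L and B="fact k * (B \<tau> + 1) ^ k"])
      fix IJ :: "(nat \<Rightarrow> nat) \<times> (nat \<Rightarrow> nat)"
      show "M IJ \<tau> = 0" using \<tau> by (simp add: Z_def M_def)
      fix t assume t: "t \<in> ball \<tau> \<delta>"
      have "t \<in> ball \<tau> e1" "t \<in> ball \<tau> e2" using t \<delta> by auto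
      then have "K t \<le> K \<tau> + 1" "B t \<le> B \<tau> + 1" using e1 e2 by (auto intro: less_imp_le)
      then show "norm (M IJ t) \<le> fact k * (B \<tau> + 1) ^ k"
        using bnd[of t] unfolding M_def by (intro norm_minor_le) (blast intro: order_trans)
      obtain d where d: "(M IJ has_vector_derivative d) (at t)"
        and d_le: "\<And>b. (\<And>I J. norm (minor k (G t) I J) \<le> b) \<Longrightarrow> norm d \<le> 2 * real k * K t * b"
        using minor_flow_derivative_bound[OF der row bnd, where k=k and I="fst IJ" and J="snd IJ"] unfolding M_def[abs_def] by blast
      have "norm d \<le> L * b" if b: "\<And>I J. norm (minor k (G t) I J) \<le> b" for b
      proof -
        have "0 \<le> b" using b norm_ge_zero order_trans by blast
        moreover have "2 * real k * K t \<le> L"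
          unfolding L_def using mult_left_mono[OF \<open>K t \<le> K \<tau> + 1\<close>, of "2 * real k"] by simp
        ultimately show ?thesis
          using d_le[OF b] mult_right_mono order_trans by blast
      qed
      then show "\<exists>d. (M IJ has_vector_derivative d) (at t) \<and>
          (\<forall>b. (\<forall>j. norm (M j t) \<le> b) \<longrightarrow> norm d \<le> L * b)"
        using d by (auto simp: M_def)
    qed (use \<delta> t in auto)
    then have "ball \<tau> \<delta> \<subseteq> Z"
      by (auto simp: Z_def M_def)
    then show "\<exists>\<delta>>0. ball \<tau> \<delta> \<subseteq> Z" using \<delta>(1) by blast
  qed
  moreover have "\<tau> \<in> Z" by (simp add: Z_def init)
  ultimately have "Z = UNIV"
    using connected_UNIV[where 'a=real] by (metis clopen empty_iff)
  then show ?thesis by (auto simp: Z_def)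
qed

section \<open>Kronecker's theorem\<close>

text \<open>Induction on the size. If the smaller minors on the first columns vanish too, a relation
  is already known; otherwise an arbitrary row is appended to a nonzero minor, and expansion along
  that row is the relation.\<close>

lemma minors_vanish_imp_column_relation:
  assumes "\<And>I. minor k G I (\<lambda>j. j) = 0"
  shows "\<exists>c. (\<exists>j<k. c j \<noteq> 0) \<and> (\<forall>i. (\<Sum>j<k. c j * G i j) = 0)"
  using assms
proof (induction k)
  case 0
  \<comment> \<open>The empty minor is 1, so the assumption is contradictory.\<close>
  then show ?case by (simp add: minor_leibniz)
next
  case (Suc k)
  show ?case
  proof (cases "\<forall>I. minor k G I (\<lambda>j. j) = 0")
    case True
    then obtain c j where c: "j < k" "c j \<noteq> 0" "\<And>i. (\<Sum>j<k. c j * G i j) = 0"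
      using Suc.IH by blast
    show ?thesis
      by (rule exI[where x="c(k := 0)"]) (use c in \<open>auto intro!: exI[where x=j]\<close>)
  next
    case False
    then obtain I where I: "minor k G I (\<lambda>j. j) \<noteq> 0" by blast
    \<comment> \<open>The cofactors of the appended row. They do not involve that row, so the same
      coefficients serve for every \<open>i\<close>; \<open>c k\<close> is the nonzero
      minor.\<close>
    define c where "c j = (- 1) ^ (k + j) *
        Determinant.det (mat k k (\<lambda>(p, q). G (I p) (if q < j then q else Suc q)))" for j
    have "mat k k (\<lambda>(p, q). G (I p) (if q < k then q else Suc q)) = mat k k (\<lambda>(p, q). G (I p) q)"
      by (rule eq_matI) auto
    then have "c k \<noteq> 0" using I by (simp add: c_def minor_def)
    moreover have "(\<Sum>j<Suc k. c j * G i j) = 0" for i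
    proof -
      let ?A = "mat (Suc k) (Suc k) (\<lambda>(p, q). G ((I(k := i)) p) q)"
      have "mat_delete ?A k j = mat k k (\<lambda>(p, q). G (I p) (if q < j then q else Suc q))" for j
        unfolding mat_delete_def by (rule eq_matI) auto
      then have "cofactor ?A k j = c j" for j
        by (simp add: cofactor_def c_def)
      then have "(\<Sum>j<Suc k. c j * G i j) = (\<Sum>j<Suc k. ?A $$ (k, j) * cofactor ?A k j)"
        by (intro sum.cong) (auto simp: mult.commute)
      also have "\<dots> = minor (Suc k) G (I(k := i)) (\<lambda>j. j)"
        unfolding minor_def by (rule laplace_expansion_row[symmetric]) auto
      finally show ?thesis using Suc.prems by simp
    qed
    ultimately show ?thesis by blast
  qed
qed

text \<open>The matrix factors through dimension \<open>k\<close>, one less than the size of the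
  minor.\<close>

lemma minor_low_rank:
  assumes "\<And>i j. G i j = (\<Sum>r<k. F i r * H r j)"
  shows "minor (Suc k) G I J = 0"
proof -
  \<comment> \<open>Both factors are padded to square matrices. The last column of \<open>?F\<close>
    is zero, so the extra row of \<open>?H\<close> does no harm and \<open>?F\<close> is
    singular.\<close>
  let ?F = "mat (Suc k) (Suc k) (\<lambda>(p, r). if r < k then F (I p) r else 0)"
  let ?H = "mat (Suc k) (Suc k) (\<lambda>(r, q). H r (J q))"
  have "mat (Suc k) (Suc k) (\<lambda>(p, q). G (I p) (J q)) = ?F * ?H"
    by (rule eq_matI) (auto simp: assms scalar_prod_def atLeast0LessThan)
  then have "minor (Suc k) G I J = Determinant.det ?F * Determinant.det ?H"
    unfolding minor_def by (simp add: Determinant.det_mult[of _ "Suc k"])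
  moreover have "Determinant.det ?F = 0"
  proof -
    have "?F *\<^sub>v unit_vec (Suc k) k = 0\<^sub>v (Suc k)"
      by (rule eq_vecI) (auto simp: scalar_prod_def unit_vec_def)
    moreover have "unit_vec (Suc k) k \<noteq> (0\<^sub>v (Suc k) :: complex vec)"
      by simp
    moreover have "unit_vec (Suc k) k \<in> carrier_vec (Suc k)"
      by simp
    ultimately show ?thesis
      unfolding det_0_iff_vec_prod_zero[OF mat_carrier] by blast
  qed
  ultimately show ?thesis by simp
qed

text \<open>The shift leaves out \<open>u 0\<close>: if numerator and denominator both have degree
  at most \<open>D\<close>, the recurrence for the coefficients holds only from index 1 on.\<close>

abbreviation hankel :: "(nat \<Rightarrow> complex) \<Rightarrow> nat \<Rightarrow> nat \<Rightarrow> complex" where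
  "hankel u \<equiv> \<lambda>n m. u (Suc (n + m))"

text \<open>As \<open>b 0\<close> is nonzero, the recurrence expresses every column from the
  \<open>D\<close>-th on through the \<open>D\<close> columns before it, hence by strong induction
  through the first \<open>D\<close>. The Hankel matrix thus factors through dimension
  \<open>D\<close>.\<close>

lemma recurrence_imp_minors_vanish:
  fixes w :: "nat \<Rightarrow> complex"
  assumes b0: "b 0 \<noteq> 0" and rec: "\<And>n. (\<Sum>j\<le>D. b j * w (n + (D - j))) = 0"
  shows "minor (Suc D) (\<lambda>n m. w (n + m)) I J = 0"
proof -
  have "\<exists>g. \<forall>n. w (n + m) = (\<Sum>r<D. w (n + r) * g r)" for m
  proof (induction m rule: less_induct)
    case (less m)
    show ?case
    proof (cases "m < D")
      case True
      have "w (n + m) = (\<Sum>r<D. w (n + r) * (if r = m then 1 else 0))" for n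
        using True by (simp add: if_distrib[of "\<lambda>x. _ * x"] cong: if_cong)
      then show ?thesis
        by (intro exI[where x="\<lambda>r. if r = m then 1 else 0"] allI)
    next
      case False
      have "\<forall>j\<in>{1..D}. \<exists>g. \<forall>n. w (n + (m - j)) = (\<Sum>r<D. w (n + r) * g r)"
      proof
        fix j assume "j \<in> {1..D}"
        with False have "m - j < m" by auto
        then show "\<exists>g. \<forall>n. w (n + (m - j)) = (\<Sum>r<D. w (n + r) * g r)"
          by (rule less.IH)
      qed
      then obtain g where g: "\<And>j n. j \<in> {1..D} \<Longrightarrow> w (n + (m - j)) = (\<Sum>r<D. w (n + r) * g j r)"
        by metis
      have "w (n + m) = (\<Sum>r<D. w (n + r) * (- (\<Sum>j=1..D. b j * g j r) / b 0))" for n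
      proof -
        have "(\<Sum>j\<le>D. b j * w (n + (m - j))) = 0"
        proof -
          \<comment> \<open>Since \<open>D \<le> m\<close>, the truncated subtractions are exact,
            and the recurrence at \<open>n + (m - D)\<close> has leading entry
            \<open>w (n + m)\<close>.\<close>
          have "n + (m - j) = n + (m - D) + (D - j)" if "j \<in> {..D}" for j
            using that False by simp
          then have "(\<Sum>j\<le>D. b j * w (n + (m - j))) = (\<Sum>j\<le>D. b j * w (n + (m - D) + (D - j)))"
            by (intro sum.cong) (simp_all only:)
          then show ?thesis by (simp only: rec)
        qed
        moreover have "(\<Sum>j\<le>D. b j * w (n + (m - j))) = b 0 * w (n + m) + (\<Sum>j=1..D. b j * w (n + (m - j)))"
          by (simp add: sum.atMost_shift sum.atLeast1_atMost_eq lessThan_Suc_atMost)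
        moreover have "(\<Sum>j=1..D. b j * w (n + (m - j))) = (\<Sum>r<D. w (n + r) * (\<Sum>j=1..D. b j * g j r))"
          using g by (simp add: sum_distrib_left mult_ac) (rule sum.swap)
        ultimately have "b 0 * w (n + m) = - (\<Sum>r<D. w (n + r) * (\<Sum>j=1..D. b j * g j r))"
          by (simp add: eq_neg_iff_add_eq_0)
        then show ?thesis
          using b0 by (simp add: field_simps sum_negf flip: sum_divide_distrib)
      qed
      then show ?thesis
        by (intro exI[where x="\<lambda>r. - (\<Sum>j=1..D. b j * g j r) / b 0"] allI)
    qed
  qed
  then obtain g where "\<And>n m. w (n + m) = (\<Sum>r<D. w (n + r) * g m r)" by metis
  then show ?thesis by (rule minor_low_rank[where F="\<lambda>n r. w (n + r)" and H="\<lambda>r m. g m r"])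
qed

section \<open>Polynomial quotients as formal power series\<close>

lemma poly_sums:
  fixes z :: complex
  shows "(\<lambda>n. coeff p n * z ^ n) sums poly p z"
  using sums_finite[of "{..degree p}" "\<lambda>n. coeff p n * z ^ n"]
  by (simp add: poly_altdef coeff_eq_0)

text \<open>Both series converge absolutely on the closed disk, so the Cauchy product identifies the
  product of functions with the formal product.\<close>

lemma hardy_fun_mult_poly_sums:
  assumes u: "summable (\<lambda>n. norm (u n))" and z: "norm z \<le> 1"
  shows "(\<lambda>n. fps_nth (fps_of_poly B * Abs_fps u) n * z ^ n) sums (poly B z * hardy_fun u z)"
proof -
  have "summable (\<lambda>n. norm (coeff B n * z ^ n))"
    using summable_finite[of "{..degree B}" "\<lambda>n. norm (coeff B n * z ^ n)"] by (simp add: coeff_eq_0)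
  moreover have "summable (\<lambda>n. norm (u n * z ^ n))"
    using z by (intro summable_comparison_test'[OF u, of 0])
      (simp add: norm_mult norm_power mult_left_le power_le_one)
  ultimately have "(\<lambda>n. \<Sum>i\<le>n. (coeff B i * z ^ i) * (u (n - i) * z ^ (n - i))) sums
      ((\<Sum>n. coeff B n * z ^ n) * (\<Sum>n. u n * z ^ n))"
    by (rule Cauchy_product_sums)
  moreover have "(\<Sum>i\<le>n. (coeff B i * z ^ i) * (u (n - i) * z ^ (n - i)))
      = fps_nth (fps_of_poly B * Abs_fps u) n * z ^ n" for n
  proof -
    have "(\<Sum>i\<le>n. (coeff B i * z ^ i) * (u (n - i) * z ^ (n - i)))
        = (\<Sum>i\<le>n. (coeff B i * u (n - i)) * z ^ n)"
      by (intro sum.cong) (auto simp: mult_ac simp flip: power_add)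
    then show ?thesis
      by (simp add: fps_mult_nth sum_distrib_right atLeast0AtMost)
  qed
  ultimately show ?thesis
    using poly_sums[of B z] by (simp add: sums_iff hardy_fun_def)
qed

lemma sums_hardy_fun:
  assumes u: "summable (\<lambda>n. norm (u n))" and z: "norm z \<le> 1"
  shows "(\<lambda>n. u n * z ^ n) sums hardy_fun u z"
proof -
  have "summable (\<lambda>n. norm (u n * z ^ n))"
    using z by (intro summable_comparison_test'[OF u, of 0])
      (simp add: norm_mult norm_power mult_left_le power_le_one)
  then show ?thesis
    unfolding hardy_fun_def by (rule summable_sums[OF summable_norm_cancel])
qed

text \<open>Turns the analytic condition into an identity of formal power series, where coefficients
  can be compared and factors cancelled. Forwards, a power series that sums to zero on the disk is
  zero; backwards, one divides by the nonvanishing values of \<open>B\<close>.\<close>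

lemma rational_sums_iff_fps:
  fixes u :: "nat \<Rightarrow> complex"
  assumes u: "summable (\<lambda>n. norm (u n))" and B: "\<And>z. z \<in> cball 0 1 \<Longrightarrow> poly B z \<noteq> 0"
  shows "(\<forall>z\<in>cball 0 1. (\<lambda>n. u n * z ^ n) sums (poly A z / poly B z)) \<longleftrightarrow>
         fps_of_poly B * Abs_fps u = fps_of_poly A"
proof
  assume *: "\<forall>z\<in>cball 0 1. (\<lambda>n. u n * z ^ n) sums (poly A z / poly B z)"
  define F where "F = fps_of_poly B * Abs_fps u - fps_of_poly A"
  have F: "(\<lambda>n. fps_nth F n * z ^ n) sums 0" if "norm z \<le> 1" for z
  proof -
    have "hardy_fun u z = poly A z / poly B z"
      using * that sums_hardy_fun[OF u that] by (auto intro: sums_unique2)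
    then have "(\<lambda>n. fps_nth (fps_of_poly B * Abs_fps u) n * z ^ n) sums poly A z"
      using hardy_fun_mult_poly_sums[OF u that, of B] B[of z] that by simp
    from sums_diff[OF this poly_sums[of A z]] show ?thesis
      by (simp add: F_def left_diff_distrib)
  qed
  \<comment> \<open>Convergence at 1 gives radius at least 1; the identity theorem needs a positive
    radius.\<close>
  have "ereal (norm (1 :: complex)) \<le> conv_radius (fps_nth F)"
    using F[of 1] by (intro conv_radius_geI) (auto simp: sums_iff)
  then have "0 < fps_conv_radius F"
    unfolding fps_conv_radius_def by (rule less_le_trans[rotated]) simp
  moreover have "\<forall>\<^sub>F z in nhds 0. eval_fps F z = eval_fps 0 z"
    unfolding eventually_nhds_metric eval_fps_def
    using F by (auto simp: sums_iff intro!: exI[where x=1])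
  ultimately have "F = 0"
    by (intro eval_fps_eqD) simp_all
  then show "fps_of_poly B * Abs_fps u = fps_of_poly A"
    by (simp add: F_def)
next
  assume *: "fps_of_poly B * Abs_fps u = fps_of_poly A"
  show "\<forall>z\<in>cball 0 1. (\<lambda>n. u n * z ^ n) sums (poly A z / poly B z)"
  proof
    fix z :: complex assume z: "z \<in> cball 0 1"
    have "(\<lambda>n. coeff A n * z ^ n) sums (poly B z * hardy_fun u z)"
      using hardy_fun_mult_poly_sums[OF u, of z B] z * by simp
    with poly_sums have "poly A z = poly B z * hardy_fun u z" by (rule sums_unique2)
    then show "(\<lambda>n. u n * z ^ n) sums (poly A z / poly B z)"
      using sums_hardy_fun[OF u, of z] z B[OF z] by (simp add: field_simps)
  qed
qed

lemma fps_mult_poly_nth_tail: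
  fixes u :: "nat \<Rightarrow> complex"
  assumes "degree B \<le> D"
  shows "fps_nth (fps_of_poly B * Abs_fps u) (Suc (n + D)) = (\<Sum>j\<le>D. coeff B j * u (Suc (n + (D - j))))"
proof -
  have "fps_nth (fps_of_poly B * Abs_fps u) (Suc (n + D)) = (\<Sum>j\<le>Suc (n + D). coeff B j * u (Suc (n + D) - j))"
    by (simp add: fps_mult_nth atLeast0AtMost)
  also have "\<dots> = (\<Sum>j\<le>D. coeff B j * u (Suc (n + D) - j))"
    using assms by (intro sum.mono_neutral_right) (auto simp: coeff_eq_0)
  also have "\<dots> = (\<Sum>j\<le>D. coeff B j * u (Suc (n + (D - j))))"
    by (intro sum.cong) (auto simp: Suc_diff_le)
  finally show ?thesis .
qed

text \<open>The coefficients of the numerator vanish above index \<open>D\<close>. This is a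
  recurrence for the shifted sequence, with leading coefficient the nonzero value of
  \<open>B\<close> at 0.\<close>

lemma rational_manifold_imp_minors_vanish:
  assumes u: "summable (\<lambda>n. norm (u n))" and "u \<in> rational_manifold D"
  shows "minor (Suc D) (hankel u) I J = 0"
proof -
  obtain A B where AB: "degree A \<le> D" "degree B \<le> D" "\<And>z. z \<in> cball 0 1 \<Longrightarrow> poly B z \<noteq> 0"
    "fps_of_poly B * Abs_fps u = fps_of_poly A"
    using assms rational_sums_iff_fps[OF u] unfolding rational_manifold_def by blast
  show ?thesis
  proof (rule recurrence_imp_minors_vanish[where w="\<lambda>n. u (Suc n)" and b="coeff B"])
    show "coeff B 0 \<noteq> 0" using AB(3)[of 0] by (simp add: poly_0_coeff_0)
    show "(\<Sum>j\<le>D. coeff B j * u (Suc (n + (D - j)))) = 0" for n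
      using fps_mult_poly_nth_tail[OF AB(2), of u n] AB(1,4) by (simp add: coeff_eq_0)
  qed
qed

text \<open>A relation among the first \<open>D + 1\<close> Hankel columns is a recurrence, that is,
  a nonzero polynomial \<open>C\<close> whose product with \<open>u\<close> is a polynomial.
  Reducing the fraction may lower the degree, hence \<open>D'\<close>.\<close>

lemma minors_vanish_imp_rational_manifold:
  assumes u: "summable (\<lambda>n. norm (u n))" and minors: "\<And>I J. minor (Suc D) (hankel u) I J = 0"
  shows "\<exists>D'\<le>D. u \<in> rational_manifold D'"
proof -
  obtain c j where c: "j \<le> D" "c j \<noteq> 0" "\<And>n. (\<Sum>j\<le>D. c j * u (Suc (n + j))) = 0"
    using minors_vanish_imp_column_relation[of "Suc D" "hankel u", OF minors]
    by (auto simp: lessThan_Suc_atMost less_Suc_eq_le)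
  \<comment> \<open>The coefficients are reversed: the indices of \<open>u\<close> rise with
    \<open>j\<close> in the relation but fall in a convolution.\<close>
  define C where "C = (\<Sum>i\<le>D. monom (c (D - i)) i)"
  have coeff_C: "coeff C i = (if i \<le> D then c (D - i) else 0)" for i
    by (auto simp: C_def coeff_sum)
  have degC: "degree C \<le> D" by (rule degree_le) (simp add: coeff_C)
  have C0: "C \<noteq> 0"
    using c(1,2) coeff_C[of "D - j"] by auto
  \<comment> \<open>\<open>N\<close> is the product of \<open>C\<close> and \<open>u\<close> cut off
    above degree \<open>D\<close>; the relation says that nothing is lost.\<close>
  define N where "N = (\<Sum>i\<le>D. monom (fps_nth (fps_of_poly C * Abs_fps u) i) i)"
  have coeff_N: "coeff N i = (if i \<le> D then fps_nth (fps_of_poly C * Abs_fps u) i else 0)" for i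
    by (auto simp: N_def coeff_sum)
  have degN: "degree N \<le> D" by (rule degree_le) (simp add: coeff_N)
  have CN: "fps_of_poly C * Abs_fps u = fps_of_poly N"
  proof (rule fps_ext)
    fix n
    show "fps_nth (fps_of_poly C * Abs_fps u) n = fps_nth (fps_of_poly N) n"
    proof (cases "n \<le> D")
      case False
      then obtain m where n: "n = Suc (m + D)"
        by (metis add.commute less_imp_Suc_add linorder_not_less)
      have "fps_nth (fps_of_poly C * Abs_fps u) n = (\<Sum>i\<le>D. c (D - i) * u (Suc (m + (D - i))))"
        unfolding n fps_mult_poly_nth_tail[OF degC] by (simp add: coeff_C)
      also have "\<dots> = (\<Sum>i\<le>D. c i * u (Suc (m + i)))"
        by (rule sum.reindex_bij_witness[where i="\<lambda>i. D - i" and j="\<lambda>i. D - i"]) auto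
      finally show ?thesis using c(3) False by (simp add: coeff_N)
    qed (simp add: coeff_N)
  qed
  define g where "g = gcd N C"
  have g0: "g \<noteq> 0" using C0 by (simp add: g_def)
  obtain A B where AB: "N = A * g" "C = B * g" "coprime A B"
    using gcd_coprime_exists[of N C] g0 unfolding g_def by blast
  have eq: "fps_of_poly B * Abs_fps u = fps_of_poly A"
  proof -
    have "fps_of_poly g * (fps_of_poly B * Abs_fps u) = fps_of_poly g * fps_of_poly A"
      using CN by (simp add: AB fps_of_poly_mult mult_ac)
    then show ?thesis using g0 by simp
  qed
  \<comment> \<open>On the disk \<open>A\<close> is \<open>B\<close> times the finite value of
    \<open>u\<close>, so a zero of \<open>B\<close> would be a common zero, against
    coprimality.\<close>
  have B: "poly B z \<noteq> 0" if "z \<in> cball 0 1" for z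
  proof
    assume z: "poly B z = 0"
    have "(\<lambda>n. coeff A n * z ^ n) sums (poly B z * hardy_fun u z)"
      using hardy_fun_mult_poly_sums[OF u, of z B] that eq by simp
    with poly_sums have "poly A z = poly B z * hardy_fun u z" by (rule sums_unique2)
    then have "poly A z = 0" using z by simp
    then show False using z \<open>coprime A B\<close> coprime_poly_0 by blast
  qed
  have deg: "degree A \<le> D" "degree B \<le> D"
  proof -
    show "degree B \<le> D" using degC C0 g0 AB(2) by (auto simp: degree_mult_eq)
    show "degree A \<le> D" using degN g0 AB(1) by (cases "A = 0") (auto simp: degree_mult_eq)
  qed
  have "u \<in> rational_manifold (max (degree A) (degree B))"
    unfolding rational_manifold_def
  proof (intro CollectI exI conjI)
    show "coprime A B" by (fact AB(3))
    show "\<forall>z\<in>cball 0 1. poly B z \<noteq> 0" using B by blast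
    show "\<forall>z\<in>cball 0 1. (\<lambda>n. u n * z ^ n) sums (poly A z / poly B z)"
      using rational_sums_iff_fps[OF u B] eq by blast
  qed (auto simp: max_def)
  then show ?thesis using deg by (meson max.bounded_iff)
qed

text \<open>Two reduced fractions of the same series have numerators that divide each other, and
  likewise denominators, so the degrees agree.\<close>

lemma rational_manifold_unique:
  assumes u: "summable (\<lambda>n. norm (u n))" and "u \<in> rational_manifold D" "u \<in> rational_manifold D'"
  shows "D = D'"
proof -
  obtain A B where AB: "degree A \<le> D" "degree B \<le> D" "degree A = D \<or> degree B = D" "coprime A B"
     "\<And>z. z \<in> cball 0 1 \<Longrightarrow> poly B z \<noteq> 0" "fps_of_poly B * Abs_fps u = fps_of_poly A"
    using assms(2) rational_sums_iff_fps[OF u] unfolding rational_manifold_def by blast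
  obtain A' B' where AB': "degree A' \<le> D'" "degree B' \<le> D'" "degree A' = D' \<or> degree B' = D'" "coprime A' B'"
     "\<And>z. z \<in> cball 0 1 \<Longrightarrow> poly B' z \<noteq> 0" "fps_of_poly B' * Abs_fps u = fps_of_poly A'"
    using assms(3) rational_sums_iff_fps[OF u] unfolding rational_manifold_def by blast
  \<comment> \<open>Both sides are the product of \<open>B\<close>, \<open>B'\<close> and the series
    of \<open>u\<close>.\<close>
  have "fps_of_poly (A * B') = fps_of_poly (A' * B)"
    by (simp add: fps_of_poly_mult flip: AB(6) AB'(6))
  then have eq: "A * B' = A' * B" by simp
  have same: "degree P = degree Q" if "P dvd Q" "Q dvd P" for P Q :: "complex poly"
    using that dvd_imp_degree_le by (cases "P = 0"; cases "Q = 0") (auto intro: antisym)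
  have num_dvd: "P dvd P'" if "P * Q' = P' * Q" "coprime P Q" for P Q P' Q' :: "complex poly"
  proof -
    have "P dvd P' * Q" by (simp flip: that(1))
    then show ?thesis using that(2) by (simp add: coprime_dvd_mult_left_iff)
  qed
  have den_dvd: "Q dvd Q'" if "P * Q' = P' * Q" "coprime P Q" for P Q P' Q' :: "complex poly"
  proof -
    have "Q dvd P * Q'" by (simp add: that(1))
    then show ?thesis using that(2) by (simp add: coprime_commute coprime_dvd_mult_right_iff)
  qed
  have "A dvd A'" "A' dvd A" "B dvd B'" "B' dvd B"
    using num_dvd[OF eq AB(4)] den_dvd[OF eq AB(4)]
      num_dvd[OF eq[symmetric] AB'(4)] den_dvd[OF eq[symmetric] AB'(4)] by blast+
  then have "degree A = degree A'" "degree B = degree B'" using same by blast+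
  then show ?thesis using AB(1-3) AB'(1-3) by auto
qed

section \<open>The equation in Fourier modes\<close>

text \<open>Termwise integration over a bounded interval, justified by the summable uniform bounds
  \<open>c k\<close>.\<close>

lemma fourier_coeff_sums:
  fixes f :: "nat \<Rightarrow> real \<Rightarrow> complex"
  assumes cont: "\<And>k. continuous_on UNIV (f k)"
    and le: "\<And>k \<theta>. norm (f k \<theta>) \<le> c k" and c: "summable c"
  shows "(\<lambda>k. fourier_coeff (f k) n) sums fourier_coeff (\<lambda>\<theta>. \<Sum>k. f k \<theta>) n"
proof -
  let ?I = "{0..2 * pi}"
  let ?F = "\<lambda>k \<theta>. indicat_real ?I \<theta> *\<^sub>R (f k \<theta> * cis (- (real_of_int n * \<theta>)))"
  have int: "integrable lebesgue (?F k)" for k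
  proof -
    have "continuous_on (cbox 0 (2 * pi)) (\<lambda>\<theta>. f k \<theta> * cis (- (real_of_int n * \<theta>)))"
      by (intro continuous_intros continuous_on_subset[OF cont]) auto
    from absolutely_integrable_continuous[OF this] show ?thesis
      by (simp add: set_integrable_def)
  qed
  have c0: "0 \<le> c k" for k using le[of k 0] norm_ge_zero order_trans by blast
  have F_le: "norm (?F k \<theta>) \<le> indicat_real ?I \<theta> * c k" for k \<theta>
    using le[of k \<theta>] by (simp add: norm_mult mult_left_mono)
  have "integrable lebesgue (\<lambda>\<theta>. indicat_real ?I \<theta> * c k)" for k
    by (intro integrable_mult_left) (simp add: integrable_indicator_iff)
  then have "(LINT \<theta>|lebesgue. norm (?F k \<theta>)) \<le> (LINT \<theta>|lebesgue. indicat_real ?I \<theta> * c k)" for k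
    using int F_le by (intro integral_mono integrable_norm)
  then have "(LINT \<theta>|lebesgue. norm (?F k \<theta>)) \<le> 2 * pi * c k" for k
    by simp
  then have "summable (\<lambda>k. LINT \<theta>|lebesgue. norm (?F k \<theta>))"
    by (intro summable_comparison_test'[OF summable_mult[OF c, of "2 * pi"], of 0]) simp
  moreover have sF: "summable (\<lambda>k. norm (?F k \<theta>))" for \<theta>
  proof (rule summable_comparison_test'[OF c, of 0])
    show "norm (norm (?F k \<theta>)) \<le> c k" for k
      using F_le[of \<theta> k] c0[of k] by (auto simp: indicator_def split: if_splits)
  qed
  ultimately have "(\<lambda>k. LINT \<theta>|lebesgue. ?F k \<theta>) sums (LINT \<theta>|lebesgue. (\<Sum>k. ?F k \<theta>))"
    using int by (intro sums_integral) auto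
  moreover have "(\<Sum>k. ?F k \<theta>) = indicat_real ?I \<theta> *\<^sub>R ((\<Sum>k. f k \<theta>) * cis (- (real_of_int n * \<theta>)))" for \<theta>
  proof -
    have "summable (\<lambda>k. f k \<theta>)"
      by (rule summable_comparison_test'[OF c, of 0]) (rule le)
    then show ?thesis
      by (simp only: suminf_scaleR_right suminf_mult2 summable_mult2)
  qed
  ultimately show ?thesis
    unfolding fourier_coeff_def set_lebesgue_integral_def by (simp add: sums_divide)
qed

lemma fourier_coeff_mult_left: "fourier_coeff (\<lambda>\<theta>. a * f \<theta>) n = a * fourier_coeff f n"
  unfolding fourier_coeff_def by (simp add: mult.assoc)

lemma fourier_coeff_mult_cis:
  "fourier_coeff (\<lambda>\<theta>. f \<theta> * cis (- (real m * \<theta>))) n = fourier_coeff f (n + int m)"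
  unfolding fourier_coeff_def by (simp add: mult.assoc cis_mult algebra_simps)

lemma fourier_coeff_cis: "fourier_coeff (\<lambda>\<theta>. cis (real m * \<theta>)) (int n) = (if m = n then 1 else 0)"
proof -
  define k where "k = real m - real n"
  have "(LINT \<theta>:{0..2 * pi}|lebesgue. cis (k * \<theta>)) = integral {0..2 * pi} (\<lambda>\<theta>. cis (k * \<theta>))"
  proof (rule set_lebesgue_integral_eq_integral(2))
    have "continuous_on (cbox 0 (2 * pi)) (\<lambda>\<theta>. cis (k * \<theta>))"
      by (intro continuous_intros)
    from absolutely_integrable_continuous[OF this]
    show "set_integrable lebesgue {0..2 * pi} (\<lambda>\<theta>. cis (k * \<theta>))" by simp
  qed
  moreover have "integral {0..2 * pi} (\<lambda>\<theta>. cis (k * \<theta>)) = (if m = n then 2 * pi else 0)"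
  proof (cases "m = n")
    case False
    then have k: "k \<noteq> 0" by (simp add: k_def)
    have "((\<lambda>\<theta>. cis (k * \<theta>)) has_integral
        (cis (k * (2 * pi)) / (\<i> * k) - cis (k * 0) / (\<i> * k))) {0..2 * pi}"
    proof (rule fundamental_theorem_of_calculus)
      fix x
      show "((\<lambda>x. cis (k * x) / (\<i> * k)) has_vector_derivative cis (k * x)) (at x within {0..2 * pi})"
        unfolding has_vector_derivative_def
        using k by (auto intro!: derivative_eq_intros simp: scaleR_conv_of_real mult_ac)
    qed simp
    moreover have "cis (k * (2 * pi)) = 1"
    proof -
      have "k * (2 * pi) = 2 * pi * of_int (int m - int n)" by (simp add: k_def)
      then show ?thesis by (metis Ints_of_int cis_multiple_2pi)
    qed
    ultimately show ?thesis using False by (simp add: integral_unique)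
  qed (simp add: k_def scaleR_conv_of_real)
  ultimately show ?thesis
    unfolding fourier_coeff_def by (simp add: cis_mult k_def algebra_simps)
qed

section \<open>Boundary values on the circle and the cubic term\<close>

lemma hardy_fun_cis: "hardy_fun g (cis \<theta>) = (\<Sum>n. g n * cis (real n * \<theta>))"
  unfolding hardy_fun_def by (simp add: Complex.DeMoivre)

lemma fourier_coeff_hardy_fun:
  assumes g: "summable (\<lambda>n. norm (g n))"
  shows "fourier_coeff (\<lambda>\<theta>. hardy_fun g (cis \<theta>)) (int n) = g n"
proof -
  have "(\<lambda>k. fourier_coeff (\<lambda>\<theta>. g k * cis (real k * \<theta>)) (int n)) sums
      fourier_coeff (\<lambda>\<theta>. \<Sum>k. g k * cis (real k * \<theta>)) (int n)"
    by (rule fourier_coeff_sums[OF _ _ g]) (auto intro!: continuous_intros simp: norm_mult)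
  moreover have "(\<lambda>k. fourier_coeff (\<lambda>\<theta>. g k * cis (real k * \<theta>)) (int n)) sums g n"
    unfolding fourier_coeff_mult_left fourier_coeff_cis
    using sums_single[of n g] by (simp add: if_distrib[of "\<lambda>x. _ * x"] cong: if_cong)
  ultimately show ?thesis
    unfolding hardy_fun_cis by (rule sums_unique2)
qed

lemma continuous_on_hardy_fun_cis:
  assumes g: "summable (\<lambda>n. norm (g n))"
  shows "continuous_on UNIV (\<lambda>\<theta>. hardy_fun g (cis \<theta>))"
proof -
  have "uniform_limit UNIV (\<lambda>n \<theta>. \<Sum>i<n. g i * cis (real i * \<theta>)) (\<lambda>\<theta>. \<Sum>i. g i * cis (real i * \<theta>)) sequentially"
    by (rule Weierstrass_m_test[OF _ g]) (simp add: norm_mult)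
  then show ?thesis
    unfolding hardy_fun_cis
    by (rule uniform_limit_theorem[rotated]) (auto intro!: always_eventually continuous_intros)
qed

lemma norm_hardy_fun_cis_le:
  assumes g: "summable (\<lambda>n. norm (g n))"
  shows "norm (hardy_fun g (cis \<theta>)) \<le> (\<Sum>n. norm (g n))"
  unfolding hardy_fun_cis using g by (intro norm_suminf_le) (simp_all add: norm_mult)

text \<open>The Taylor coefficients of u^2, which enter because |u|^2 u is u^2 times the conjugate
  of u.\<close>

definition self_conv :: "(nat \<Rightarrow> complex) \<Rightarrow> nat \<Rightarrow> complex" where
  "self_conv u n = (\<Sum>i\<le>n. u i * u (n - i))"

lemma summable_self_conv:
  assumes u: "summable (\<lambda>n. norm (u n))"
  shows "summable (\<lambda>n. norm (self_conv u n))"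
proof (rule summable_comparison_test'[of _ 0])
  show "summable (\<lambda>n. \<Sum>i\<le>n. norm (u i) * norm (u (n - i)))"
    using u by (intro summable_Cauchy_product) simp_all
  show "norm (norm (self_conv u n)) \<le> (\<Sum>i\<le>n. norm (u i) * norm (u (n - i)))" for n
    unfolding self_conv_def by (simp flip: norm_mult) (rule norm_sum)
qed

lemma hardy_fun_self_conv:
  assumes u: "summable (\<lambda>n. norm (u n))"
  shows "hardy_fun (self_conv u) (cis \<theta>) = (hardy_fun u (cis \<theta>))\<^sup>2"
proof -
  have s: "summable (\<lambda>n. norm (u n * cis \<theta> ^ n))"
    using u by (simp add: norm_mult norm_power)
  have "(\<Sum>i\<le>n. (u i * cis \<theta> ^ i) * (u (n - i) * cis \<theta> ^ (n - i))) = self_conv u n * cis \<theta> ^ n" for n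
    unfolding self_conv_def sum_distrib_right
    by (intro sum.cong) (auto simp: mult_ac simp flip: power_add)
  with Cauchy_product[OF s s] show ?thesis
    unfolding hardy_fun_def by (simp add: power2_eq_square)
qed

text \<open>The conjugate factor of |u|^2 u is expanded in its Fourier series; its
  \<open>m\<close>-th mode multiplies u^2 by \<open>cis (- (real m * \<theta>))\<close>, which
  shifts Fourier indices by \<open>m\<close>.\<close>

lemma szego_proj_cubic_sums:
  assumes u: "summable (\<lambda>n. norm (u n))"
  shows "(\<lambda>m. cnj (u m) * self_conv u (n + m)) sums szego_proj (cubic u) n"
proof -
  let ?G = "\<lambda>\<theta>. hardy_fun (self_conv u) (cis \<theta>)"
  note g = summable_self_conv[OF u]
  have "cubic u = (\<lambda>\<theta>. \<Sum>m. cnj (u m) * (?G \<theta> * cis (- (real m * \<theta>))))"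
  proof
    fix \<theta>
    let ?H = "hardy_fun u (cis \<theta>)"
    have "(\<lambda>m. u m * cis \<theta> ^ m) sums ?H"
      using sums_hardy_fun[OF u] by simp
    then have "(\<lambda>m. cnj (u m * cis \<theta> ^ m) * ?G \<theta>) sums (cnj ?H * ?G \<theta>)"
      by (intro sums_mult2) (simp only: sums_cnj)
    moreover have "cnj (u m * cis \<theta> ^ m) * ?G \<theta> = cnj (u m) * (?G \<theta> * cis (- (real m * \<theta>)))" for m
      by (simp add: Complex.DeMoivre cis_cnj)
    moreover have "cubic u \<theta> = cnj ?H * ?G \<theta>"
      unfolding cubic_def hardy_fun_self_conv[OF u]
      by (simp only: complex_norm_square) (simp add: power2_eq_square mult_ac)
    ultimately show "cubic u \<theta> = (\<Sum>m. cnj (u m) * (?G \<theta> * cis (- (real m * \<theta>))))"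
      by (simp only: sums_unique)
  qed
  moreover have "(\<lambda>m. fourier_coeff (\<lambda>\<theta>. cnj (u m) * (?G \<theta> * cis (- (real m * \<theta>)))) (int n)) sums
      fourier_coeff (\<lambda>\<theta>. \<Sum>m. cnj (u m) * (?G \<theta> * cis (- (real m * \<theta>)))) (int n)"
  proof (rule fourier_coeff_sums)
    show "summable (\<lambda>m. norm (u m) * (\<Sum>k. norm (self_conv u k)))"
      using u by (rule summable_mult2)
    show "norm (cnj (u m) * (?G \<theta> * cis (- (real m * \<theta>)))) \<le> norm (u m) * (\<Sum>k. norm (self_conv u k))" for m \<theta>
      using norm_hardy_fun_cis_le[OF g, of \<theta>] by (simp add: norm_mult mult_left_mono)
    show "continuous_on UNIV (\<lambda>\<theta>. cnj (u m) * (?G \<theta> * cis (- (real m * \<theta>))))" for m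
      by (intro continuous_intros continuous_on_hardy_fun_cis g)
  qed
  moreover have "fourier_coeff (\<lambda>\<theta>. cnj (u m) * (?G \<theta> * cis (- (real m * \<theta>)))) (int n)
      = cnj (u m) * self_conv u (n + m)" for m
    unfolding fourier_coeff_mult_left fourier_coeff_mult_cis
    using fourier_coeff_hardy_fun[OF g, of "n + m"] by simp
  ultimately show ?thesis
    by (simp add: szego_proj_def)
qed

text \<open>With u = u_0 + z v and v given by \<open>shift_adj u\<close>, this compares coefficients
  in u^2 = u_0^2 + 2 u_0 z v + z^2 v^2. It is the cancellation behind the truncated equation: in the
  positive modes only products containing u_0 or its conjugate survive.\<close>

lemma self_conv_Suc_Suc:
  "self_conv u (Suc (Suc n)) = 2 * u 0 * u (Suc (Suc n)) + self_conv (shift_adj u) n"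
proof -
  have "self_conv u (Suc (Suc n)) = u 0 * u (Suc (Suc n)) + (\<Sum>i\<le>Suc n. u (Suc i) * u (Suc n - i))"
    unfolding self_conv_def by (subst sum.atMost_Suc_shift) simp
  also have "(\<Sum>i\<le>Suc n. u (Suc i) * u (Suc n - i)) = (\<Sum>i\<le>n. u (Suc i) * u (Suc (n - i))) + u (Suc (Suc n)) * u 0"
    by (simp add: Suc_diff_le)
  finally show ?thesis
    by (simp add: self_conv_def shift_adj_def)
qed

lemma truncated_szego_rhs_Suc:
  assumes u: "summable (\<lambda>n. norm (u n))"
  shows "(\<lambda>m. 2 * u 0 * (cnj (u (Suc m)) * u (Suc (Suc (N + m))))) sums
           (truncated_szego_rhs u (Suc N) - cnj (u 0) * self_conv u (Suc N))"
proof -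
  have v: "summable (\<lambda>n. norm (shift_adj u n))"
    using u by (simp add: shift_adj_def summable_Suc_iff[of "\<lambda>n. norm (u n)"])
  \<comment> \<open>The term \<open>m = 0\<close> is split off; the rest then matches the series for
    \<open>shift_adj u\<close> term by term.\<close>
  have "(\<lambda>m. cnj (u (Suc m)) * self_conv u (Suc (Suc (N + m)))) sums
      (szego_proj (cubic u) (Suc N) - cnj (u 0) * self_conv u (Suc N))"
    using szego_proj_cubic_sums[OF u, of "Suc N"]
      sums_Suc_iff[of "\<lambda>m. cnj (u m) * self_conv u (Suc N + m)"] by simp
  from sums_diff[OF this szego_proj_cubic_sums[OF v, of N]]
  have "(\<lambda>m. 2 * u 0 * (cnj (u (Suc m)) * u (Suc (Suc (N + m))))) sums
      (szego_proj (cubic u) (Suc N) - cnj (u 0) * self_conv u (Suc N) - szego_proj (cubic (shift_adj u)) N)"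
    by (rule sums_cong[THEN iffD1, rotated]) (simp add: self_conv_Suc_Suc shift_adj_def[abs_def] algebra_simps)
  then show ?thesis
    by (simp add: truncated_szego_rhs_def shift_def algebra_simps)
qed

section \<open>Evolution of the shifted Hankel matrix\<close>

text \<open>The matrix \<open>X\<close> in \<open>\<Gamma>' = X \<Gamma> + \<Gamma> X\<^sup>T\<close>.\<close>

definition flow_matrix :: "(nat \<Rightarrow> complex) \<Rightarrow> nat \<Rightarrow> nat \<Rightarrow> complex" where
  "flow_matrix u n l = - \<i> * (if l \<le> n then cnj (u 0) * u (n - l) else u 0 * cnj (u (l - n)))"

text \<open>The matrix is Toeplitz. Entries with \<open>l \<le> n\<close>, diagonal included, give a
  partial convolution of \<open>u\<close> with itself; the others give one copy of the series that
  carries the factor 2 in the equation.\<close>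

lemma flow_matrix_sums:
  assumes u: "summable (\<lambda>n. norm (u n))"
  shows "(\<lambda>l. flow_matrix u n l * hankel u l m) sums
     (- \<i> * (cnj (u 0) * (\<Sum>i\<le>n. u i * u (Suc (n + m) - i)) +
             u 0 * (\<Sum>l. cnj (u (Suc l)) * u (Suc (Suc (n + m + l))))))"
proof -
  let ?f = "\<lambda>l. flow_matrix u n l * hankel u l m"
  let ?g = "\<lambda>l. cnj (u (Suc l)) * u (Suc (Suc (n + m + l)))"
  have "norm (u k) \<le> (\<Sum>n. norm (u n))" for k
    using sum_le_suminf[OF u, of "{k}"] by simp
  then have "summable ?g"
    using u by (intro summable_mult_bounded[where B="\<Sum>n. norm (u n)"]) (simp_all add: summable_Suc_iff[of "\<lambda>n. norm (u n)"])
  then have "(\<lambda>l. - \<i> * u 0 * ?g l) sums (- \<i> * u 0 * suminf ?g)"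
    by (intro sums_mult summable_sums)
  moreover have "?f (l + Suc n) = - \<i> * u 0 * ?g l" for l
    by (simp add: flow_matrix_def Suc_diff_le add_ac)
  ultimately have "(\<lambda>l. ?f (l + Suc n)) sums (- \<i> * u 0 * suminf ?g)"
    by simp
  then have "?f sums (- \<i> * u 0 * suminf ?g + (\<Sum>l<Suc n. ?f l))"
    by (rule sums_iff_shift[where n="Suc n", THEN iffD1])
  moreover have "(\<Sum>l<Suc n. ?f l) = - \<i> * cnj (u 0) * (\<Sum>i\<le>n. u i * u (Suc (n + m) - i))"
  proof -
    have "(\<Sum>l<Suc n. ?f l) = (\<Sum>l\<le>n. - \<i> * cnj (u 0) * (u (n - l) * u (Suc (l + m))))"
      by (intro sum.cong) (auto simp: flow_matrix_def)
    also have "\<dots> = (\<Sum>i\<le>n. - \<i> * cnj (u 0) * (u i * u (Suc (n + m) - i)))"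
      by (rule sum.reindex_bij_witness[where i="\<lambda>i. n - i" and j="\<lambda>i. n - i"])
        (auto simp: Suc_diff_le add.commute)
    finally show ?thesis by (simp only: sum_distrib_left)
  qed
  moreover have "- \<i> * u 0 * suminf ?g + - \<i> * cnj (u 0) * (\<Sum>i\<le>n. u i * u (Suc (n + m) - i))
      = - \<i> * (cnj (u 0) * (\<Sum>i\<le>n. u i * u (Suc (n + m) - i)) + u 0 * suminf ?g)"
    by (simp add: algebra_simps)
  ultimately show ?thesis
    by (simp only:)
qed

text \<open>The convolution of index \<open>n + m + 1\<close> has \<open>n + m + 2\<close> terms:
  the \<open>n + 1\<close> with \<open>i \<le> n\<close> and, after reflection, the
  \<open>m + 1\<close> with \<open>i \<le> m\<close>. The doubled series is shared equally. This
  even splitting relies on the shift by one in the Hankel matrix.\<close>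

lemma hankel_flow:
  assumes u: "summable (\<lambda>n. norm (u n))"
  shows "- \<i> * truncated_szego_rhs u (Suc (n + m)) =
    (\<Sum>l. flow_matrix u n l * hankel u l m) + (\<Sum>l. flow_matrix u m l * hankel u n l)"
proof -
  let ?S = "\<Sum>l. cnj (u (Suc l)) * u (Suc (Suc (n + m + l)))"
  have "norm (u k) \<le> (\<Sum>n. norm (u n))" for k
    using sum_le_suminf[OF u, of "{k}"] by simp
  then have "summable (\<lambda>l. cnj (u (Suc l)) * u (Suc (Suc (n + m + l))))"
    using u by (intro summable_mult_bounded[where B="\<Sum>n. norm (u n)"]) (simp_all add: summable_Suc_iff[of "\<lambda>n. norm (u n)"])
  then have rhs: "truncated_szego_rhs u (Suc (n + m)) = cnj (u 0) * self_conv u (Suc (n + m)) + 2 * u 0 * ?S"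
    using truncated_szego_rhs_Suc[OF u, of "n + m"] by (simp add: sums_iff suminf_mult algebra_simps)
  have conv: "self_conv u (Suc (n + m)) =
      (\<Sum>i\<le>n. u i * u (Suc (n + m) - i)) + (\<Sum>i\<le>m. u i * u (Suc (n + m) - i))"
  proof -
    have "{..Suc (n + m)} = {..n} \<union> {Suc n..Suc (n + m)}" by auto
    then have "self_conv u (Suc (n + m)) =
        (\<Sum>i\<le>n. u i * u (Suc (n + m) - i)) + (\<Sum>i=Suc n..Suc (n + m). u i * u (Suc (n + m) - i))"
      unfolding self_conv_def by (simp only:) (rule sum.union_disjoint; auto)
    moreover have "(\<Sum>i=Suc n..Suc (n + m). u i * u (Suc (n + m) - i)) = (\<Sum>i\<le>m. u i * u (Suc (n + m) - i))"
      by (rule sum.reindex_bij_witness[where i="\<lambda>i. Suc (n + m) - i" and j="\<lambda>i. Suc (n + m) - i"]) auto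
    ultimately show ?thesis by simp
  qed
  \<comment> \<open>By symmetry of the Hankel matrix, the column action is the row action with
    \<open>n\<close> and \<open>m\<close> exchanged.\<close>
  have "(\<Sum>l. flow_matrix u m l * hankel u n l) = (\<Sum>l. flow_matrix u m l * hankel u l n)"
    by (simp add: add.commute)
  also have "\<dots> = - \<i> * (cnj (u 0) * (\<Sum>i\<le>m. u i * u (Suc (n + m) - i)) + u 0 * ?S)"
    using flow_matrix_sums[OF u, of m n] by (simp only: sums_iff add.commute[of m n])
  finally have right: "(\<Sum>l. flow_matrix u m l * hankel u n l) =
      - \<i> * (cnj (u 0) * (\<Sum>i\<le>m. u i * u (Suc (n + m) - i)) + u 0 * ?S)" .
  have left: "(\<Sum>l. flow_matrix u n l * hankel u l m) =
      - \<i> * (cnj (u 0) * (\<Sum>i\<le>n. u i * u (Suc (n + m) - i)) + u 0 * ?S)"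
    using flow_matrix_sums[OF u, of n m] by (simp only: sums_iff)
  show ?thesis
    unfolding left right rhs conv by (simp add: algebra_simps)
qed

text \<open>In modulus, row \<open>n\<close> is \<open>norm (u 0)\<close> times the list u_n, ...,
  u_0, u_1, u_2, ..., whose two halves are each bounded by the full sum, uniformly in
  \<open>n\<close>.\<close>

lemma flow_matrix_row:
  assumes u: "summable (\<lambda>n. norm (u n))"
  shows "summable (\<lambda>l. norm (flow_matrix u n l))"
    and "(\<Sum>l. norm (flow_matrix u n l)) \<le> 2 * (\<Sum>n. norm (u n))\<^sup>2"
proof -
  let ?W = "\<Sum>n. norm (u n)"
  let ?f = "\<lambda>l. norm (flow_matrix u n l)"
  have tail: "?f (l + Suc n) = norm (u 0) * norm (u (Suc l))" for l
    by (simp add: flow_matrix_def norm_mult Suc_diff_le)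
  have u': "summable (\<lambda>l. norm (u (Suc l)))" using u by (simp add: summable_Suc_iff[of "\<lambda>n. norm (u n)"])
  then have "summable (\<lambda>l. ?f (l + Suc n))"
    unfolding tail by (rule summable_mult)
  then show *: "summable ?f" by (rule summable_iff_shift[THEN iffD1])
  have head: "(\<Sum>l<Suc n. ?f l) = norm (u 0) * (\<Sum>i\<le>n. norm (u i))"
  proof -
    have "(\<Sum>l<Suc n. ?f l) = (\<Sum>l\<le>n. norm (u 0) * norm (u (n - l)))"
      by (intro sum.cong) (auto simp: flow_matrix_def norm_mult)
    also have "\<dots> = (\<Sum>i\<le>n. norm (u 0) * norm (u i))"
      by (rule sum.reindex_bij_witness[where i="\<lambda>i. n - i" and j="\<lambda>i. n - i"]) auto
    finally show ?thesis by (simp only: sum_distrib_left)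
  qed
  have W: "norm (u 0) \<le> ?W" "(\<Sum>i\<le>n. norm (u i)) \<le> ?W"
    using sum_le_suminf[OF u, of "{0}"] sum_le_suminf[OF u, of "{..n}"] by simp_all
  have W': "(\<Sum>l. norm (u (Suc l))) \<le> ?W"
    using suminf_split_head[OF u] by simp
  have W0: "0 \<le> ?W" using u by (rule suminf_nonneg) simp
  have "suminf ?f = (\<Sum>l. norm (u 0) * norm (u (Suc l))) + norm (u 0) * (\<Sum>i\<le>n. norm (u i))"
    using suminf_split_initial_segment[OF *, of "Suc n"] by (simp only: tail head)
  also have "\<dots> = norm (u 0) * (\<Sum>l. norm (u (Suc l))) + norm (u 0) * (\<Sum>i\<le>n. norm (u i))"
    using u' by (simp add: suminf_mult)
  also have "\<dots> \<le> ?W * ?W + ?W * ?W"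
    using W W' W0 u' by (intro add_mono mult_mono) (auto intro: suminf_nonneg sum_nonneg)
  finally show "suminf ?f \<le> 2 * ?W\<^sup>2"
    by (simp add: power2_eq_square)
qed

section \<open>Solutions in Sobolev spaces\<close>

text \<open>Comparison with a power of \<open>n\<close> whose exponent is below -1 exactly because
  \<open>s > 1/2\<close>.\<close>

lemma summable_sobolev_weight:
  assumes "s > 1/2"
  shows "summable (\<lambda>n. (1 + (real n)\<^sup>2) powr (- s))"
\<comment> \<open>The comparison starts at 1: at \<open>n = 0\<close> the weight is 1, but
  \<open>0 powr (- 2 * s)\<close> is 0.\<close>
proof (rule summable_comparison_test'[where N=1])
  show "summable (\<lambda>n. real n powr (- 2 * s))"
    using assms by (subst summable_real_powr_iff) simp
  fix n :: nat assume "1 \<le> n"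
  then have "(1 + (real n)\<^sup>2) powr (- s) \<le> ((real n)\<^sup>2) powr (- s)"
    using assms by (intro powr_mono2') auto
  also have "\<dots> = real n powr (- 2 * s)"
    using \<open>1 \<le> n\<close> by (simp add: powr_powr flip: powr_numeral)
  finally show "norm ((1 + (real n)\<^sup>2) powr (- s)) \<le> real n powr (- 2 * s)" by simp
qed

text \<open>The embedding into the Wiener algebra, by Cauchy-Schwarz with weights of exponents
  \<open>- s / 2\<close> and \<open>s / 2\<close>. Estimating partial sums yields summability and
  the bound together.\<close>

lemma sobolev_imp_l1:
  assumes s: "s > 1/2" and v: "v \<in> sobolev_plus s"
  shows "summable (\<lambda>n. norm (v n))"
    and "(\<Sum>n. norm (v n)) \<le> sqrt (\<Sum>n. (1 + (real n)\<^sup>2) powr (- s)) * sobolev_norm s v"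
proof -
  let ?w = "\<lambda>n. (1 + (real n)\<^sup>2)"
  let ?C = "\<Sum>n. ?w n powr (- s)"
  let ?M = "sqrt ?C * sobolev_norm s v"
  have w: "0 < ?w n" for n by (simp add: add_pos_nonneg)
  have sq: "(?w n powr (a / 2))\<^sup>2 = ?w n powr a" for n a
    unfolding power2_eq_square[of "?w n powr (a / 2)"] by (simp flip: powr_add)
  have v': "summable (\<lambda>n. ?w n powr s * (norm (v n))\<^sup>2)"
    using v by (simp add: sobolev_plus_def)
  have partial: "(\<Sum>n<N. norm (v n)) \<le> ?M" for N
  proof -
    have eq: "(\<Sum>n<N. norm (v n)) = (\<Sum>n<N. ?w n powr (- s / 2) * (?w n powr (s / 2) * norm (v n)))"
      using w by (intro sum.cong) (simp_all add: less_imp_neq[symmetric] flip: mult.assoc powr_add)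
    have "(\<Sum>n<N. norm (v n))\<^sup>2 \<le> (\<Sum>n<N. (?w n powr (- s / 2))\<^sup>2) * (\<Sum>n<N. (?w n powr (s / 2) * norm (v n))\<^sup>2)"
      unfolding eq by (rule Cauchy_Schwarz_ineq_sum)
    also have "\<dots> = (\<Sum>n<N. ?w n powr (- s)) * (\<Sum>n<N. ?w n powr s * (norm (v n))\<^sup>2)"
      using sq[of _ "- s"] sq[of _ s] by (simp only: power_mult_distrib)
    also have "\<dots> \<le> ?C * (\<Sum>n. ?w n powr s * (norm (v n))\<^sup>2)"
      using summable_sobolev_weight[OF s] v'
      by (intro mult_mono sum_le_suminf) (auto intro!: suminf_nonneg sum_nonneg)
    finally have "(\<Sum>n<N. norm (v n))\<^sup>2 \<le> ?C * (\<Sum>n. ?w n powr s * (norm (v n))\<^sup>2)" .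
    then show ?thesis
      unfolding sobolev_norm_def real_sqrt_mult[symmetric] by (rule real_le_rsqrt)
  qed
  show *: "summable (\<lambda>n. norm (v n))"
    by (rule summableI_nonneg_bounded[OF _ partial]) simp
  show "(\<Sum>n. norm (v n)) \<le> ?M"
    using * partial by (intro suminf_le_const)
qed

text \<open>\<open>sobolev_norm\<close> is an infinite sum, so the distance between two times of a
  solution is meaningful once the difference lies in the space.\<close>

lemma sobolev_plus_diff:
  assumes "a \<in> sobolev_plus s" "b \<in> sobolev_plus s"
  shows "(\<lambda>n. a n - b n) \<in> sobolev_plus s"
proof -
  let ?w = "\<lambda>n. (1 + (real n)\<^sup>2) powr s"
  have "summable (\<lambda>n. 2 * (?w n * (norm (a n))\<^sup>2) + 2 * (?w n * (norm (b n))\<^sup>2))"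
    using assms unfolding sobolev_plus_def by (intro summable_add summable_mult) simp_all
  moreover have "norm (?w n * (norm (a n - b n))\<^sup>2) \<le> 2 * (?w n * (norm (a n))\<^sup>2) + 2 * (?w n * (norm (b n))\<^sup>2)" for n
  proof -
    have "(norm (a n - b n))\<^sup>2 \<le> (norm (a n) + norm (b n))\<^sup>2"
      by (intro power_mono norm_triangle_ineq4) simp
    also have "\<dots> \<le> 2 * (norm (a n))\<^sup>2 + 2 * (norm (b n))\<^sup>2"
      using zero_le_power2[of "norm (a n) - norm (b n)"] by (simp add: power2_eq_square algebra_simps)
    finally have "?w n * (norm (a n - b n))\<^sup>2 \<le> ?w n * (2 * (norm (a n))\<^sup>2 + 2 * (norm (b n))\<^sup>2)"
      by (rule mult_left_mono) simp
    then show ?thesis by (simp add: algebra_simps)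
  qed
  ultimately show ?thesis
    unfolding sobolev_plus_def by (auto intro: summable_comparison_test'[of _ 0])
qed

text \<open>By the reverse triangle inequality and the embedding, the Wiener norm is continuous in
  time; this provides the continuous bounds for the Gronwall argument.\<close>

lemma solution_l1:
  assumes s: "s > 1/2" and sol: "truncated_szego_solution s u"
  shows "summable (\<lambda>n. norm (u t n))" and "continuous_on UNIV (\<lambda>t. \<Sum>n. norm (u t n))"
proof -
  have mem: "u t \<in> sobolev_plus s" for t
    using sol by (simp add: truncated_szego_solution_def)
  show l1: "summable (\<lambda>n. norm (u t n))" for t
    using sobolev_imp_l1(1)[OF s mem] .
  define C where "C = sqrt (\<Sum>n. (1 + (real n)\<^sup>2) powr (- s))"
  have "((\<lambda>r. \<Sum>n. norm (u r n)) \<longlongrightarrow> (\<Sum>n. norm (u t n))) (at t)" for t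
  proof (rule LIM_zero_cancel, rule Lim_null_comparison)
    show "((\<lambda>r. C * sobolev_norm s (\<lambda>n. u r n - u t n)) \<longlongrightarrow> 0) (at t)"
      using sol by (intro tendsto_mult_right_zero) (simp add: truncated_szego_solution_def)
    have "norm ((\<Sum>n. norm (u r n)) - (\<Sum>n. norm (u t n))) \<le> C * sobolev_norm s (\<lambda>n. u r n - u t n)" for r
    proof -
      note d = sobolev_imp_l1[OF s sobolev_plus_diff[OF mem[of r] mem[of t]]]
      have "norm ((\<Sum>n. norm (u r n)) - (\<Sum>n. norm (u t n))) = norm (\<Sum>n. norm (u r n) - norm (u t n))"
        using l1 by (simp add: suminf_diff)
      also have "\<dots> \<le> (\<Sum>n. norm (u r n - u t n))"
        using d(1) by (intro norm_suminf_le) (simp_all add: norm_triangle_ineq3)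
      finally show ?thesis using d(2) by (simp add: C_def)
    qed
    then show "\<forall>\<^sub>F r in at t. norm ((\<Sum>n. norm (u r n)) - (\<Sum>n. norm (u t n)))
        \<le> C * sobolev_norm s (\<lambda>n. u r n - u t n)"
      by (intro always_eventually allI)
  qed
  then show "continuous_on UNIV (\<lambda>t. \<Sum>n. norm (u t n))"
    by (simp add: continuous_on_def)
qed

text \<open>The times \<open>\<tau>\<close> and \<open>t\<close> come in either order, so vanishing
  passes forwards and backwards.\<close>

lemma solution_hankel_minors_vanish:
  assumes s: "s > 1/2" and sol: "truncated_szego_solution s u"
    and init: "\<And>I J. minor k (hankel (u \<tau>)) I J = 0"
  shows "minor k (hankel (u t)) I J = 0"
proof (rule minors_vanish_forever[where G="\<lambda>t. hankel (u t)" and a="\<lambda>t. flow_matrix (u t)" and \<tau>=\<tau>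
      and K="\<lambda>t. 2 * (\<Sum>n. norm (u t n))\<^sup>2" and B="\<lambda>t. \<Sum>n. norm (u t n)"])
  note l1 = solution_l1[OF s sol]
  fix t n m
  obtain d where d: "((\<lambda>r. u r (Suc (n + m))) has_vector_derivative d) (at t)"
    "\<i> * d = truncated_szego_rhs (u t) (Suc (n + m))"
    using sol unfolding truncated_szego_solution_def by blast
  then have "d = - \<i> * truncated_szego_rhs (u t) (Suc (n + m))"
    by (simp flip: d(2))
  also note hankel_flow[OF l1(1)]
  finally show "((\<lambda>r. hankel (u r) n m) has_vector_derivative
      (\<Sum>l. flow_matrix (u t) n l * hankel (u t) l m) + (\<Sum>l. flow_matrix (u t) m l * hankel (u t) n l)) (at t)"
    using d(1) by simp
  show "norm (hankel (u t) n m) \<le> (\<Sum>n. norm (u t n))"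
    using sum_le_suminf[OF l1(1), of "{Suc (n + m)}"] by simp
qed (use flow_matrix_row solution_l1[OF s sol] init in \<open>auto intro!: continuous_intros\<close>)

theorem proposition3p3:
  fixes D :: nat and s :: real and u :: "real \<Rightarrow> nat \<Rightarrow> complex"
  assumes "D > 0" and "s > 1/2"
    and "truncated_szego_solution s u"
    and "u 0 \<in> rational_manifold D"
  shows "\<forall>t. u t \<in> rational_manifold D"
proof
  fix t
  have l1: "summable (\<lambda>n. norm (u t n))" for t
    using assms(2,3) by (rule solution_l1)
  have step: "\<exists>D'\<le>k. u r \<in> rational_manifold D'" if "u q \<in> rational_manifold k" for q r k
  proof -
    have "minor (Suc k) (hankel (u q)) I J = 0" for I J
      using l1 that by (rule rational_manifold_imp_minors_vanish)
    then have "minor (Suc k) (hankel (u r)) I J = 0" for I J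
      by (rule solution_hankel_minors_vanish[OF assms(2,3)])
    with l1 show ?thesis by (rule minors_vanish_imp_rational_manifold)
  qed
  obtain D' where D': "D' \<le> D" "u t \<in> rational_manifold D'"
    using step[OF assms(4)] by blast
  \<comment> \<open>Returning from \<open>t\<close> to 0 excludes a drop of the degree: uniqueness
    at 0 turns both inequalities into equalities.\<close>
  obtain D'' where D'': "D'' \<le> D'" "u 0 \<in> rational_manifold D''"
    using step[OF D'(2)] by blast
  have "D'' = D" using rational_manifold_unique[OF l1 D''(2) assms(4)] .
  with D' D'' show "u t \<in> rational_manifold D" by simp
qed

end
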